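(* Let $d,n\in\mathbb{N}$. Let $\gamma:[0,1]\to\mathbb{T}^d$ be a continuous, piecewise differentiable closed curve with at most finitely many self-intersections, with trajectory $\Gamma=\gamma([0,1])$ whose covering radius satisfies $\delta_\Gamma\le 1/8$, and let $w:\Gamma\to[0,\infty)$ be a non-negative weight function such that $$\frac{1}{\ell(\gamma)}\int_\gamma f(x)w(x)\,\mathrm{d}\sigma(x)=\int_{\mathbb{T}^d}f(x)\,\mathrm{d}x\qquad\text{for all } f\in\Pi_{2n}^d.$$ Then $$\ell(\gamma)\ge\frac{0.94}{\sqrt{2d+1}}\,(2n+1)^{d-1}.$$
   Context: $\mathbb{N}=\{1,2,\dots\}$. $\mathbb{T}^d\simeq[0,1)^d$ is the $d$-dimensional torus ($\mathbb{R}^d/\mathbb{Z}^d$) with normalized Lebesgue measure $\mathrm{d}x$. For $N\in\mathbb{N}$, $\Pi_N^d$ is the space of trigonometric polynomials $f(x)=\sum_{k\in\mathbb{Z}^d,\ \|k\|_\infty\le N}c_k\,\mathrm{e}^{2\pi i k\cdot x}$, $c_k\in\mathbb{C}$, on $\mathbb{T}^d$. Covering radius of a set $Y\subset\mathbb{T}^d$: $\delta_Y=\sup_{x\in\mathbb{T}^d}\inf_{y\in Y}|y-x|_\infty$ with $|x-y|_\infty=\inf_{z\in\mathbb{Z}^d}\|x-y+z\|_\infty$. Integration along a curve is with respect to arc length, $\int_\gamma g(x)\,\mathrm{d}\sigma(x)=\int_0^1 g(\gamma(t))\|\dot\gamma(t)\|_2\,\mathrm{d}t$, and the length is $\ell(\gamma)=\int_\gamma\mathrm{d}\sigma(x)=\int_0^1\|\dot\gamma(t)\|_2\,\mathrm{d}t$.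 The weight $w$ is implicitly assumed measurable so that all integrals are well defined. *)

theory Defs
  imports "HOL-Analysis.Analysis"
begin

section \<open>The torus\<close>

definition torus_rel :: "real ^ 'd \<Rightarrow> real ^ 'd \<Rightarrow> bool" where
  "torus_rel x y \<longleftrightarrow> (\<forall>i. x $ i - y $ i \<in> \<int>)"

lemma equivp_torus_rel: "equivp torus_rel"
proof (rule equivpI)
  show "reflp torus_rel"
    by (auto simp: reflp_def torus_rel_def)
  show "symp torus_rel"
    unfolding symp_def torus_rel_def by (metis Ints_minus minus_diff_eq)
  show "transp torus_rel"
    unfolding transp_def torus_rel_def
  proof safe
    fix x y z :: "real ^ 'd" and i
    assume "\<forall>i. x $ i - y $ i \<in> \<int>" "\<forall>i. y $ i - z $ i \<in> \<int>"
    then have "(x $ i - y $ i) + (y $ i - z $ i) \<in> \<int>"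
      by (intro Ints_add) auto
    then show "x $ i - z $ i \<in> \<int>" by simp
  qed
qed

quotient_type 'd torus = "real ^ ('d::finite)" / torus_rel
  morphisms rep_torus to_torus
  by (rule equivp_torus_rel)

lemma to_torus_eq_iff: "to_torus x = to_torus y \<longleftrightarrow> (\<forall>i. x $ i - y $ i \<in> \<int>)"
  by (simp add: torus.abs_eq_iff torus_rel_def)

lemma to_torus_surj: "\<exists>x. a = to_torus x"
  by (metis Quotient3_abs_rep Quotient3_torus)

definition int_vecs :: "(real ^ 'd) set" where
  "int_vecs = {z. \<forall>i. z $ i \<in> \<int>}"

lemma zero_int_vecs [simp]: "0 \<in> int_vecs"
  by (simp add: int_vecs_def)

lemma int_vecs_add: "u \<in> int_vecs \<Longrightarrow> v \<in> int_vecs \<Longrightarrow> u + v \<in> int_vecs"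
  by (simp add: int_vecs_def)

lemma int_vecs_minus: "u \<in> int_vecs \<Longrightarrow> - u \<in> int_vecs"
  by (simp add: int_vecs_def)

lemma torus_rel_iff: "torus_rel x y \<longleftrightarrow> x - y \<in> int_vecs"
  by (simp add: torus_rel_def int_vecs_def)

text \<open>The metric of the torus is the one induced by the maximum norm.\<close>

definition torus_pdist :: "real ^ 'd \<Rightarrow> real ^ 'd \<Rightarrow> real" where
  "torus_pdist x y = (INF z\<in>int_vecs. infnorm (x - y + z))"

lemma bdd_below_torus: "bdd_below ((\<lambda>z. infnorm (a + z)) ` S)"
  by (rule bdd_belowI[of _ 0]) (auto simp: infnorm_pos_le)

lemma torus_pdist_le: "z \<in> int_vecs \<Longrightarrow> torus_pdist x y \<le> infnorm (x - y + z)"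
  unfolding torus_pdist_def by (rule cINF_lower[OF bdd_below_torus])

lemma torus_pdist_greatest:
  "(\<And>z. z \<in> int_vecs \<Longrightarrow> c \<le> infnorm (x - y + z)) \<Longrightarrow> c \<le> torus_pdist x y"
  unfolding torus_pdist_def using zero_int_vecs by (intro cINF_greatest) blast+

lemma torus_pdist_nonneg: "0 \<le> torus_pdist x y"
  by (rule torus_pdist_greatest) (rule infnorm_pos_le)

lemma torus_pdist_mono:
  assumes "torus_rel x x'" "torus_rel y y'"
  shows "torus_pdist x' y' \<le> torus_pdist x y"
proof (rule torus_pdist_greatest)
  fix z :: "real ^ 'a" assume "z \<in> int_vecs"
  moreover have "x - x' \<in> int_vecs" "- (y - y') \<in> int_vecs"
    using assms by (auto simp: torus_rel_iff intro: int_vecs_minus simp del: minus_diff_eq)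
  ultimately have "(x - x') + - (y - y') + z \<in> int_vecs"
    by (intro int_vecs_add)
  from torus_pdist_le[OF this, of x' y']
  show "torus_pdist x' y' \<le> infnorm (x - y + z)"
    by (simp add: algebra_simps)
qed

lemma torus_pdist_cong:
  assumes "torus_rel x x'" "torus_rel y y'"
  shows "torus_pdist x y = torus_pdist x' y'"
  using torus_pdist_mono assms equivp_symp[OF equivp_torus_rel] by (meson order_antisym)

lemma torus_pdist_commute: "torus_pdist x y = torus_pdist y x"
proof -
  have "torus_pdist x y \<le> torus_pdist y x" for x y :: "real ^ 'a"
  proof (rule torus_pdist_greatest)
    fix z :: "real ^ 'a" assume "z \<in> int_vecs"
    from torus_pdist_le[OF int_vecs_minus[OF this], of x y]
    show "torus_pdist x y \<le> infnorm (y - x + z)"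
      using infnorm_neg[of "y - x + z"] by (simp add: algebra_simps)
  qed
  then show ?thesis by (meson order_antisym)
qed

lemma torus_pdist_triangle: "torus_pdist x y \<le> torus_pdist x z + torus_pdist z y"
proof -
  have "torus_pdist x y - infnorm (x - z + u) \<le> torus_pdist z y" if u: "u \<in> int_vecs" for u
  proof (rule torus_pdist_greatest)
    fix v :: "real ^ 'a" assume v: "v \<in> int_vecs"
    have "torus_pdist x y \<le> infnorm (x - y + (u + v))"
      by (rule torus_pdist_le[OF int_vecs_add[OF u v]])
    also have "x - y + (u + v) = (x - z + u) + (z - y + v)"
      by simp
    also have "infnorm \<dots> \<le> infnorm (x - z + u) + infnorm (z - y + v)"
      by (rule infnorm_triangle)
    finally show "torus_pdist x y - infnorm (x - z + u) \<le> infnorm (z - y + v)"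
      by simp
  qed
  then have "torus_pdist x y - torus_pdist z y \<le> torus_pdist x z"
    by (intro torus_pdist_greatest) (simp add: algebra_simps)
  then show ?thesis by simp
qed

lemma component_le_infnorm: "\<bar>x $ i\<bar> \<le> infnorm (x :: real ^ 'd)"
  by (rule component_le_infnorm_cart)

lemma torus_pdist_eq_0_iff: "torus_pdist x y = 0 \<longleftrightarrow> torus_rel x y"
proof
  assume *: "torus_pdist x y = 0"
  show "torus_rel x y"
    unfolding torus_rel_def
  proof
    fix i
    let ?a = "x $ i - y $ i"
    have "\<bar>?a - of_int (round ?a)\<bar> \<le> torus_pdist x y"
    proof (rule torus_pdist_greatest)
      fix z :: "real ^ 'a" assume "z \<in> int_vecs"
      then obtain k where k: "z $ i = of_int k"
        by (auto simp: int_vecs_def elim: Ints_cases)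
      have "\<bar>?a - of_int (round ?a)\<bar> \<le> \<bar>?a - of_int (- k)\<bar>"
        by (rule round_diff_minimal)
      also have "\<dots> = \<bar>(x - y + z) $ i\<bar>"
        by (simp add: k)
      also have "\<dots> \<le> infnorm (x - y + z)"
        by (rule component_le_infnorm)
      finally show "\<bar>?a - of_int (round ?a)\<bar> \<le> infnorm (x - y + z)" .
    qed
    with * have "?a = of_int (round ?a)" by simp
    then show "?a \<in> \<int>" by (metis Ints_of_int)
  qed
next
  assume "torus_rel x y"
  then have "- (x - y) \<in> int_vecs"
    unfolding torus_rel_iff by (rule int_vecs_minus)
  from torus_pdist_le[OF this, of x y] have "torus_pdist x y \<le> 0"
    by (simp add: infnorm_0)
  then show "torus_pdist x y = 0"
    using torus_pdist_nonneg[of x y] by simp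
qed

instantiation torus :: (finite) metric_space
begin

lift_definition dist_torus :: "'a torus \<Rightarrow> 'a torus \<Rightarrow> real" is torus_pdist
  by (rule torus_pdist_cong)

definition uniformity_torus :: "('a torus \<times> 'a torus) filter" where
  "uniformity_torus = (INF e\<in>{0<..}. principal {(x, y). dist x y < e})"

definition open_torus :: "'a torus set \<Rightarrow> bool" where
  "open_torus U \<longleftrightarrow> (\<forall>x\<in>U. eventually (\<lambda>(x', y). x' = x \<longrightarrow> y \<in> U) uniformity)"

instance
proof
  show "uniformity = (INF e\<in>{0<..}. principal {(x, y :: 'a torus). dist x y < e})"
    by (rule uniformity_torus_def)
  show "open U \<longleftrightarrow> (\<forall>x\<in>U. eventually (\<lambda>(x', y). x' = x \<longrightarrow> y \<in> U) uniformity)"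
    for U :: "'a torus set"
    by (rule open_torus_def)
  show "dist x y = 0 \<longleftrightarrow> x = y" for x y :: "'a torus"
    by transfer (rule torus_pdist_eq_0_iff)
  show "dist x y \<le> dist x z + dist y z" for x y z :: "'a torus"
    by transfer (metis torus_pdist_triangle torus_pdist_commute)
qed

end

lemma dist_to_torus: "dist (to_torus x) (to_torus y) = (INF z\<in>int_vecs. infnorm (x - y + z))"
  by (simp add: dist_torus.abs_eq torus_pdist_def)

lemma dist_to_torus_le: "dist (to_torus x) (to_torus y) \<le> norm (x - y)"
  using torus_pdist_le[OF zero_int_vecs, of x y] infnorm_le_norm[of "x - y"]
  by (simp add: dist_torus.abs_eq)

lemma continuous_on_to_torus: "continuous_on A to_torus"
  unfolding continuous_on_iff
  by (metis dist_norm dist_to_torus_le le_less_trans)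

lemma borel_measurable_to_torus [measurable]: "to_torus \<in> borel_measurable borel"
  by (rule borel_measurable_continuous_onI[OF continuous_on_to_torus])

definition torus_measure :: "('d::finite) torus measure" where
  "torus_measure = distr (restrict_space lborel {x. \<forall>i. 0 \<le> x $ i \<and> x $ i < 1}) borel to_torus"

definition covering_radius :: "('d::finite) torus set \<Rightarrow> real" where
  "covering_radius Y = (SUP x. INF y\<in>Y. dist y x)"

lemma dist_torus_le_half: "dist (a :: 'd::finite torus) b \<le> 1 / 2"
proof -
  obtain x y where ab: "a = to_torus x" "b = to_torus y"
    using to_torus_surj by metis
  define z :: "real ^ 'd" where "z = (\<chi> i. - of_int (round (x $ i - y $ i)))"
  have "z \<in> int_vecs"
    by (simp add: int_vecs_def z_def)
  then have "dist a b \<le> infnorm (x - y + z)"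
    using torus_pdist_le by (simp add: ab dist_torus.abs_eq)
  also have "\<dots> \<le> 1 / 2"
  proof -
    have "\<bar>x $ i - y $ i - of_int (round (x $ i - y $ i))\<bar> \<le> 1 / 2" for i
      using of_int_round_abs_le[of "x $ i - y $ i"] by (simp add: abs_minus_commute)
    then show ?thesis
      unfolding infnorm_cart by (intro cSup_least) (auto simp: z_def)
  qed
  finally show ?thesis .
qed

text \<open>Hence the supremum in the covering radius of a nonempty set is a genuine one.\<close>

lemma bdd_above_covering_radius:
  assumes "Y \<noteq> {}"
  shows "bdd_above (range (\<lambda>x :: 'd::finite torus. INF y\<in>Y. dist y x))"
proof -
  obtain y where y: "y \<in> Y" using assms by blast
  have "(INF y\<in>Y. dist y x) \<le> 1 / 2" for x
    by (rule cINF_lower2[OF _ y dist_torus_le_half]) (rule bdd_belowI[of _ 0], auto)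
  then show ?thesis by (intro bdd_aboveI[of _ "1 / 2"]) auto
qed

section \<open>Trigonometric polynomials\<close>

lift_definition torus_char :: "int ^ 'd \<Rightarrow> ('d::finite) torus \<Rightarrow> complex" is
  "\<lambda>k x. exp (2 * of_real pi * \<i> * of_real (\<Sum>i\<in>UNIV. of_int (k $ i) * x $ i))"
proof -
  fix k :: "int ^ 'd" and x y :: "real ^ 'd"
  let ?s = "\<lambda>x. \<Sum>i\<in>UNIV. of_int (k $ i) * x $ i :: real"
  assume "torus_rel x y"
  then have "?s (x - y) \<in> \<int>"
    by (auto simp: torus_rel_def intro!: Ints_sum Ints_mult)
  then obtain m where "?s (x - y) = of_int m"
    by (auto elim: Ints_cases)
  then have m: "?s x = ?s y + of_int m"
    by (simp add: algebra_simps sum_subtractf)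
  show "exp (2 * of_real pi * \<i> * of_real (?s x)) = exp (2 * of_real pi * \<i> * of_real (?s y))"
    unfolding exp_eq m by (intro exI[of _ m]) (simp add: algebra_simps)
qed

definition freqs :: "nat \<Rightarrow> (int ^ 'd) set" where
  "freqs N = {k. \<forall>i. \<bar>k $ i\<bar> \<le> int N}"

lemma finite_freqs: "finite (freqs N :: (int ^ 'd) set)"
proof -
  have "freqs N \<subseteq> vec_lambda ` (UNIV \<rightarrow>\<^sub>E {- int N..int N} :: ('d \<Rightarrow> int) set)"
  proof
    fix k :: "int ^ 'd" assume "k \<in> freqs N"
    then have "vec_nth k \<in> UNIV \<rightarrow>\<^sub>E {- int N..int N}"
      by (auto simp: freqs_def abs_le_iff minus_le_iff)
    then show "k \<in> vec_lambda ` (UNIV \<rightarrow>\<^sub>E {- int N..int N})"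
      by (metis image_eqI vec_nth_inverse)
  qed
  then show ?thesis
    by (rule finite_subset) (intro finite_imageI finite_PiE, auto)
qed

definition trig_polys :: "nat \<Rightarrow> (('d::finite) torus \<Rightarrow> complex) set" where
  "trig_polys N = {f. \<exists>c. \<forall>x. f x = (\<Sum>k\<in>freqs N. c k * torus_char k x)}"

section \<open>Curves on the torus\<close>

text \<open>
  Continuity of a curve is the library's \<^const>\<open>path\<close>, with respect to the metric above.
  For the derivative at a time \<open>t\<close>, lift the curve pointwise to Euclidean space in a way that is
  differentiable at \<open>t\<close>; the lift may jump elsewhere. Two lifts that are both continuous at \<open>t\<close>
  differ by an integer vector which is constant near \<open>t\<close>, so the derivative is unique
  (shown below).
\<close>

definition has_velocity :: "(real \<Rightarrow> ('d::finite) torus) \<Rightarrow> real ^ 'd \<Rightarrow> real \<Rightarrow> bool" where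
  "has_velocity \<gamma> v t \<longleftrightarrow>
     (\<exists>g. (\<forall>s\<in>{0..1}. to_torus (g s) = \<gamma> s) \<and>
          (g has_vector_derivative v) (at t within {0..1}))"

lemma has_velocity_unique:
  assumes "has_velocity \<gamma> v t" "has_velocity \<gamma> v' t" "t \<in> {0..1}"
  shows "v = v'"
proof -
  obtain g h where g: "\<And>s. s \<in> {0..1} \<Longrightarrow> to_torus (g s) = \<gamma> s"
      "(g has_vector_derivative v) (at t within {0..1})"
    and h: "\<And>s. s \<in> {0..1} \<Longrightarrow> to_torus (h s) = \<gamma> s"
      "(h has_vector_derivative v') (at t within {0..1})"
    using assms(1,2) unfolding has_velocity_def by blast
  define D where "D s = g s - h s" for s
  have D: "(D has_vector_derivative (v - v')) (at t within {0..1})"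
    unfolding D_def by (intro derivative_intros g h)
  have int: "D s $ i \<in> \<int>" if "s \<in> {0..1}" for s i
    using g(1)[OF that] h(1)[OF that] by (metis D_def to_torus_eq_iff vector_minus_component)
  have "continuous (at t within {0..1}) D"
    using D by (rule has_vector_derivative_continuous)
  then have "\<forall>\<^sub>F s in at t within {0..1}. dist (D s) (D t) < 1"
    unfolding continuous_within by (rule tendstoD) simp
  moreover have "\<forall>\<^sub>F s in at t within {0..1}. s \<in> {0..1}"
    by (simp add: eventually_at_filter)
  ultimately have "\<forall>\<^sub>F s in at t within {0..1}. D s = D t"
  proof eventually_elim
    case (elim s)
    have "D s $ i = D t $ i" for i
    proof -
      have "D s $ i - D t $ i \<in> \<int>"
        using int elim assms(3) by simp
      moreover have "\<bar>D s $ i - D t $ i\<bar> < 1"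
        using elim(1) component_le_norm_cart[of "D s - D t" i] by (simp add: dist_norm)
      ultimately show ?thesis
        using Ints_nonzero_abs_less1 by force
    qed
    then show ?case by (simp add: vec_eq_iff)
  qed
  then have "((\<lambda>_. D t) has_vector_derivative (v - v')) (at t within {0..1})"
    using D assms(3) unfolding has_vector_derivative_def
    by (blast intro: has_derivative_transform_eventually)
  then have "v - v' = 0"
    using assms(3) vector_derivative_unique_within_closed_interval[of 0 1 t "\<lambda>_. D t" "v - v'" 0]
    by simp
  then show ?thesis by simp
qed

definition velocity :: "(real \<Rightarrow> ('d::finite) torus) \<Rightarrow> real \<Rightarrow> real ^ 'd" where
  "velocity \<gamma> t = (THE v. has_velocity \<gamma> v t)"

text \<open>As for \<^const>\<open>piecewise_differentiable_on\<close>, finitely many points are exempt.\<close>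

definition piecewise_differentiable_curve :: "(real \<Rightarrow> ('d::finite) torus) \<Rightarrow> bool" where
  "piecewise_differentiable_curve \<gamma> \<longleftrightarrow>
     (\<exists>S. finite S \<and> (\<forall>t\<in>{0..1} - S. \<exists>v. has_velocity \<gamma> v t))"

text \<open>The parameter \<open>1\<close> is left out, since a closed curve returns to its starting point there.\<close>

definition self_intersections :: "(real \<Rightarrow> ('d::finite) torus) \<Rightarrow> 'd torus set" where
  "self_intersections \<gamma> = {x. \<exists>s\<in>{0..<1}. \<exists>t\<in>{0..<1}. s \<noteq> t \<and> \<gamma> s = x \<and> \<gamma> t = x}"

text \<open>
  The norm in the next definition is the Euclidean one. As the integral is the Bochner integral,
  it is \<open>0\<close> for a non-integrable integrand; in particular a curve of infinite
  length gets length \<open>0\<close>. Such a curve, or a weight that is not integrable along the curve, violates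
  the identity \<open>(1 / curve_length \<gamma>) * curve_integral \<gamma> (\<lambda>x. f x * w x) = \<integral> f\<close> for the constant polynomial \<open>1\<close>, since \<open>0 \<noteq> 1\<close>.
\<close>

definition curve_integral ::
  "(real \<Rightarrow> ('d::finite) torus) \<Rightarrow> ('d torus \<Rightarrow> 'b::{banach, second_countable_topology}) \<Rightarrow> 'b"
  where
  "curve_integral \<gamma> g =
     set_lebesgue_integral lebesgue {0..1} (\<lambda>t. norm (velocity \<gamma> t) *\<^sub>R g (\<gamma> t))"

definition curve_length :: "(real \<Rightarrow> ('d::finite) torus) \<Rightarrow> real" where
  "curve_length \<gamma> = curve_integral \<gamma> (\<lambda>_. 1)"

text \<open>Measurability with respect to arc length; every Borel function on the trajectory has it.\<close>

definition curve_measurable :: "(real \<Rightarrow> ('d::finite) torus) \<Rightarrow> ('d torus \<Rightarrow> real) \<Rightarrow> bool" where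
  "curve_measurable \<gamma> w \<longleftrightarrow>
     set_borel_measurable lebesgue {0..1} (\<lambda>t. norm (velocity \<gamma> t) *\<^sub>R w (\<gamma> t))"

end

theory Submission
  imports Defs
begin

text \<open>
  Let \<open>K(x, y) = \<Sum>k. e(k \<cdot> (x - y))\<close> be the Dirichlet kernel of degree \<open>n\<close>, put \<open>N = 2n + 1\<close>, and
  write \<open>\<ell>\<close> for the length of the curve. The polynomial \<open>p(y) = \<integral> \<bar>K(x, y)\<bar>\<^sup>2 d\<sigma>(x)\<close>, with the
  unweighted arc length, has degree at most \<open>2n\<close> and mean \<open>N\<^sup>d \<ell>\<close>.
  On the other hand \<open>Re K \<ge> N\<^sup>d (1 - \<theta>)\<close> with \<open>\<theta> = 2 \<pi>\<^sup>2 n (n + 1) \<bar>x - y\<bar>\<^sup>2 / 3\<close>, because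
  \<open>cos t \<ge> 1 - t\<^sup>2 / 2\<close> and the second moments of the frequencies are diagonal; hence
  \<open>\<bar>K\<bar>\<^sup>2 \<ge> N\<^sup>2\<^sup>d (1 - 2 \<theta>)\<close>. For \<open>y\<close> on the closed curve, the points within arc length \<open>r\<close> of \<open>y\<close> form
  an arc of length \<open>2r\<close>, so \<open>p(y) \<ge> N\<^sup>2\<^sup>d (1 - 4 \<pi>\<^sup>2 n (n + 1) r\<^sup>2 / 3) 2r\<close>. Applying the quadrature
  rule, whose weights are non-negative of total mass one, to \<open>p\<close> with \<open>r = 1 / (\<pi> N)\<close> gives
  \<open>\<ell> \<ge> 4 / (3 \<pi>) N\<^sup>d\<^sup>-\<^sup>1\<close>, which suffices for \<open>d \<ge> 2\<close>. A closed curve with covering radius \<open>\<delta>\<close> has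
  length at least \<open>1 - 2 \<delta>\<close>, since it comes close to the antipode of its starting point; this makes \<open>2r \<le> \<ell>\<close> and
  settles the case \<open>d = 1\<close>.
\<close>

section \<open>Characters\<close>

lemma torus_char_to_torus:
  "torus_char k (to_torus x) = cis (2 * pi * (\<Sum>i\<in>UNIV. of_int (k $ i) * x $ i))"
  by (simp add: torus_char.abs_eq cis_conv_exp algebra_simps)

lemma torus_char_add: "torus_char (k + l) x = torus_char k x * torus_char l x"
proof -
  obtain y where "x = to_torus y" using to_torus_surj by blast
  then show ?thesis
    by (simp add: torus_char_to_torus cis_mult ring_distribs sum.distrib)
qed

lemma torus_char_uminus: "torus_char (- k) x = cnj (torus_char k x)"
proof -
  obtain y where "x = to_torus y" using to_torus_surj by blast
  then show ?thesis
    by (simp add: torus_char_to_torus cis_cnj sum_negf)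
qed

lemma torus_char_diff: "torus_char (k - l) x = torus_char k x * cnj (torus_char l x)"
  using torus_char_add[of k "- l" x] by (simp add: torus_char_uminus)

lemma norm_torus_char [simp]: "norm (torus_char k x) = 1"
proof -
  obtain y where "x = to_torus y" using to_torus_surj by blast
  then show ?thesis by (simp add: torus_char_to_torus)
qed

lemma torus_char_zero [simp]: "torus_char 0 x = 1"
proof -
  obtain y where "x = to_torus y" using to_torus_surj by blast
  then show ?thesis by (simp add: torus_char_to_torus)
qed

lemma torus_char_to_torus_mult_cnj:
  "torus_char k (to_torus x) * cnj (torus_char k (to_torus y)) =
   cis (2 * pi * (\<Sum>i\<in>UNIV. of_int (k $ i) * (x - y) $ i))"
  by (simp add: torus_char_to_torus cis_cnj cis_mult sum_subtractf ring_distribs)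

lemma to_torus_add_int_vecs: "z \<in> int_vecs \<Longrightarrow> to_torus (x + z) = to_torus x"
  by (simp add: to_torus_eq_iff int_vecs_def)

text \<open>The trigonometric function on Euclidean space is continuous, and a point near
  \<open>a\<close> in the torus metric has, after an integer shift, a representative near that of
  \<open>a\<close>. The factor \<open>sqrt (real CARD('a))\<close> in \<open>d'\<close> pays for
  passing from the maximum norm to the Euclidean one.\<close>

lemma continuous_on_torus_char: "continuous_on S (torus_char k)"
proof (rule continuous_on_subset[of UNIV])
  show "continuous_on UNIV (torus_char k)"
    unfolding continuous_on_iff
  proof safe
    fix a :: "'a torus" and e :: real assume e: "e > 0"
    obtain x where a: "a = to_torus x" using to_torus_surj by blast
    have "isCont (\<lambda>y. cis (2 * pi * (\<Sum>i\<in>UNIV. of_int (k $ i) * y $ i))) x"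
      unfolding cis_conv_exp by (intro continuous_intros)
    then obtain d where d: "d > 0" "\<And>y. dist y x < d \<Longrightarrow>
        dist (torus_char k (to_torus y)) (torus_char k a) < e"
      unfolding continuous_at_eps_delta a torus_char_to_torus using e by blast
    define d' where "d' = d / sqrt (real CARD('a))"
    have d': "d' > 0" using d(1) by (simp add: d'_def)
    show "\<exists>d>0. \<forall>b\<in>UNIV. dist b a < d \<longrightarrow> dist (torus_char k b) (torus_char k a) < e"
    proof (intro exI[of _ d'] conjI d' ballI impI)
      fix b assume b: "dist b a < d'"
      obtain y where y: "b = to_torus y" using to_torus_surj by blast
      have "(INF z\<in>int_vecs. infnorm (y - x + z)) < d'"
        using b unfolding a y dist_to_torus .
      then obtain z :: "real ^ 'a" where z: "z \<in> int_vecs" "infnorm (y - x + z) < d'"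
        using cInf_lessD[of "(\<lambda>z. infnorm (y - x + z)) ` int_vecs" d'] zero_int_vecs by blast
      have "dist (y + z) x \<le> sqrt (real CARD('a)) * infnorm (y - x + z)"
        using norm_le_infnorm[of "y - x + z"] by (simp add: dist_norm algebra_simps)
      also have "\<dots> < d"
        using z(2) by (simp add: d'_def field_simps)
      finally have "dist (torus_char k (to_torus (y + z))) (torus_char k a) < e"
        by (rule d(2))
      then show "dist (torus_char k b) (torus_char k a) < e"
        by (simp add: to_torus_add_int_vecs z y)
    qed
  qed
qed auto

lemma borel_measurable_torus_char [measurable]: "torus_char k \<in> borel_measurable borel"
  by (rule borel_measurable_continuous_onI[OF continuous_on_torus_char])

text \<open>For \<open>m\<close> nonzero the antiderivative takes equal values at 0 and 1. The
  half-open interval, which matches the fundamental domain, differs from the closed one by a null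
  set.\<close>

lemma integral_cis_unit_interval:
  "(\<integral>x. indicator {0..<1} x *\<^sub>R cis (2 * pi * (of_int m * x)) \<partial>lborel) = (if m = 0 then 1 else 0)"
proof -
  have "(\<integral>x. indicator {0..<1} x *\<^sub>R cis (2 * pi * (of_int m * x)) \<partial>lborel) =
        (\<integral>x. indicator {0..1} x *\<^sub>R cis (2 * pi * (of_int m * x)) \<partial>lborel)"
  proof (rule integral_cong_AE)
    show "AE x in lborel. indicator {0..<1} x *\<^sub>R cis (2 * pi * (real_of_int m * x)) =
        indicator {0..1} x *\<^sub>R cis (2 * pi * (real_of_int m * x))"
      using AE_lborel_singleton[of 1] by eventually_elim (auto simp: indicator_def)
  qed (auto simp: cis_conv_exp)
  also have "\<dots> = integral {0..1} (\<lambda>x. cis (2 * pi * (of_int m * x)))"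
  proof -
    have "continuous_on {0..1} (\<lambda>x. cis (2 * pi * (of_int m * x)))"
      unfolding cis_conv_exp by (intro continuous_intros)
    then have "set_integrable lborel {0..1} (\<lambda>x. cis (2 * pi * (of_int m * x)))"
      by (intro borel_integrable_atLeastAtMost') auto
    from set_borel_integral_eq_integral(2)[OF this] show ?thesis
      by (simp add: set_lebesgue_integral_def)
  qed
  also have "\<dots> = (if m = 0 then 1 else 0)"
  proof (cases "m = 0")
    case False
    define F where "F x = cis (2 * pi * (of_int m * x)) / (2 * pi * of_int m * \<i>)" for x :: real
    have "((\<lambda>x. cis (2 * pi * (of_int m * x))) has_integral F 1 - F 0) {0..1}"
    proof (rule fundamental_theorem_of_calculus)
      fix x :: real
      have "((\<lambda>z. exp (\<i> * (2 * pi * (of_int m * z))) / (2 * pi * of_int m * \<i>)) has_field_derivative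
          exp (\<i> * (2 * pi * (of_int m * of_real x)))) (at (of_real x))"
        using False by (auto intro!: derivative_eq_intros simp: field_simps)
      from has_vector_derivative_real_field[OF this]
      show "(F has_vector_derivative cis (2 * pi * (of_int m * x))) (at x within {0..1})"
        by (simp add: F_def[abs_def] cis_conv_exp)
    qed simp
    moreover have "cis (2 * pi * of_int m) = 1" by (rule cis_multiple_2pi) simp
    then have "F 1 - F 0 = 0" by (simp add: F_def)
    ultimately show ?thesis using False by (simp add: integral_unique)
  qed simp
  finally show ?thesis .
qed

text \<open>Orthogonality of characters: a character is a product of one-variable exponentials, so
  Fubini reduces the integral to the unit interval.\<close>

lemma integral_torus_char: "(\<integral>x. torus_char k x \<partial>torus_measure) = (if k = 0 then 1 else 0)"
proof -
  interpret product_sigma_finite "\<lambda>_ :: real ^ 'a. lborel :: real measure" ..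
  \<comment> \<open>Each factor carries its own indicator, so that the indicator of the cube
    factorises along with the character.\<close>
  define h where "h b x = indicator {0..<1} x *\<^sub>R cis (2 * pi * (of_int (k $ axis_index b) * x))"
    for b :: "real ^ 'a" and x :: real
  have Basis: "(Basis :: (real ^ 'a) set) = range (\<lambda>i. axis i 1)"
    by (auto simp: Basis_vec_def)
  have inj: "inj (\<lambda>i. axis i 1 :: real ^ 'a)"
    by (auto simp: inj_on_def axis_eq_axis)
  let ?C = "{x :: real ^ 'a. \<forall>i. 0 \<le> x $ i \<and> x $ i < 1}"
  have C [measurable]: "?C \<in> sets borel" by measurable
  have "(\<integral>x. torus_char k x \<partial>torus_measure) = (\<integral>x. indicator ?C x *\<^sub>R torus_char k (to_torus x) \<partial>lborel)"
    unfolding torus_measure_def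
    by (subst integral_distr) (auto simp: integral_restrict_space intro!: measurable_restrict_space1)
  also have "\<dots> = (\<integral>x. (\<Prod>b\<in>Basis. h b (x \<bullet> b)) \<partial>lborel)"
  proof (rule Bochner_Integration.integral_cong[OF refl])
    fix x :: "real ^ 'a"
    have "(\<Prod>b\<in>Basis. h b (x \<bullet> b)) = (\<Prod>i\<in>UNIV. h (axis i 1) (x $ i))"
      unfolding Basis by (subst prod.reindex[OF inj]) (simp add: inner_axis)
    also have "\<dots> = (\<Prod>i\<in>UNIV. of_real (indicator {0..<1} (x $ i))) *
        (\<Prod>i\<in>UNIV. cis (2 * pi * (of_int (k $ i) * x $ i)))"
      by (simp add: h_def scaleR_conv_of_real prod.distrib)
    also have "(\<Prod>i\<in>UNIV. complex_of_real (indicator {0..<1} (x $ i))) = of_real (indicator ?C x)"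
      by (auto simp: indicator_def)
    also have "(\<Prod>i\<in>UNIV. cis (2 * pi * (of_int (k $ i) * x $ i))) = torus_char k (to_torus x)"
      by (simp add: torus_char_to_torus cis_conv_exp exp_sum[symmetric] sum_distrib_left)
    finally show "indicator ?C x *\<^sub>R torus_char k (to_torus x) = (\<Prod>b\<in>Basis. h b (x \<bullet> b))"
      by (simp add: scaleR_conv_of_real)
  qed
  also have "\<dots> = (\<integral>f. (\<Prod>b\<in>Basis. h b (f b)) \<partial>(\<Pi>\<^sub>M b\<in>Basis. lborel))"
    unfolding h_def cis_conv_exp
    by (subst lborel_eq, subst integral_distr)
      (auto intro!: Bochner_Integration.integral_cong prod.cong simp: inner_sum_left inner_Basis if_distrib[of "(*) _"] sum.delta cong: if_cong)
  also have "\<dots> = (\<Prod>b\<in>Basis. \<integral>x. h b x \<partial>lborel)"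
  proof (rule product_integral_prod)
    fix b :: "real ^ 'a"
    show "integrable lborel (h b)"
    proof (rule Bochner_Integration.integrable_bound)
      show "integrable lborel (indicator {0..<1} :: real \<Rightarrow> real)" by simp
      show "h b \<in> borel_measurable lborel" unfolding h_def cis_conv_exp by measurable
    qed (auto simp: h_def indicator_def)
  qed simp
  also have "\<dots> = (\<Prod>i\<in>UNIV. if k $ i = 0 then 1 else 0)"
    unfolding Basis by (subst prod.reindex[OF inj]) (simp add: h_def[abs_def] integral_cis_unit_interval)
  also have "\<dots> = (if k = 0 then 1 else 0)"
    by (auto simp: vec_eq_iff)
  finally show ?thesis .
qed

section \<open>Lifts and arc length\<close>

text \<open>Each coordinate character is nowhere zero along the curve, hence has a continuous
  logarithm on the contractible interval. Its imaginary part divided by 2 pi is a coordinate of the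
  lift.\<close>

lemma lift_curve:
  fixes \<gamma> :: "real \<Rightarrow> ('d::finite) torus"
  assumes "path \<gamma>"
  obtains g where "continuous_on {0..1} g" "\<And>t. t \<in> {0..1} \<Longrightarrow> to_torus (g t) = \<gamma> t"
proof -
  have "\<exists>h. continuous_on {0..1} h \<and> (\<forall>t\<in>{0..1}. torus_char (axis i 1) (\<gamma> t) = exp (h t))" for i :: 'd
  proof -
    have "continuous_on {0..1} (\<lambda>t. torus_char (axis i 1) (\<gamma> t))"
      using assms unfolding path_def
      by (rule continuous_on_compose2[OF continuous_on_torus_char[of UNIV]]) auto
    moreover have "torus_char (axis i 1) (\<gamma> t) \<noteq> 0" for t
      by (metis norm_torus_char norm_zero zero_neq_one)
    ultimately show ?thesis
      using continuous_logarithm_on_contractible[of "{0..1::real}" "\<lambda>t. torus_char (axis i 1) (\<gamma> t)"]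
        convex_imp_contractible[of "{0..1::real}"]
      by (metis convex_real_interval(5))
  qed
  then obtain h where h: "\<And>i. continuous_on {0..1} (h i)"
    "\<And>i t. t \<in> {0..1} \<Longrightarrow> torus_char (axis i 1) (\<gamma> t) = exp (h i t)"
    by metis
  define g where "g t = (\<chi> i. Im (h i t) / (2 * pi))" for t
  show ?thesis
  proof
    show "continuous_on {0..1} g"
      unfolding g_def by (intro continuous_intros h) auto
    fix t :: real assume t: "t \<in> {0..1}"
    obtain y where y: "\<gamma> t = to_torus y" using to_torus_surj by blast
    have "g t $ i - y $ i \<in> \<int>" for i
    proof -
      have "(\<Sum>j\<in>UNIV. real_of_int (axis i 1 $ j) * y $ j) = y $ i"
        by (simp add: axis_def if_distrib[of real_of_int] if_distribR if_distrib[of "\<lambda>c. c * _"] cong: if_cong)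
      then have eq: "cis (2 * pi * y $ i) = exp (h i t)"
        using h(2)[OF t, of i] by (simp add: y torus_char_to_torus)
      then have "exp (Re (h i t)) = 1"
        by (metis norm_cis norm_exp_eq_Re)
      then have "exp (h i t) = cis (Im (h i t))"
        by (simp add: exp_eq_polar)
      then have "cis (Im (h i t)) = cis (2 * pi * y $ i)" using eq by simp
      then have "exp (\<i> * of_real (Im (h i t))) = exp (\<i> * of_real (2 * pi * y $ i))"
        by (simp add: cis_conv_exp)
      then obtain m :: int where "\<i> * of_real (Im (h i t)) = \<i> * of_real (2 * pi * y $ i) + (of_int (2 * m) * pi) * \<i>"
        unfolding exp_eq by blast
      then have "Im (h i t) = 2 * pi * y $ i + 2 * m * pi"
        by (metis (no_types, opaque_lifting) Im_i_times Re_complex_of_real complex_Im_of_int mult.commute of_real_add of_real_mult of_real_of_int_eq plus_complex.sel(2) of_int_mult of_int_numeral)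
      then have "g t $ i - y $ i = of_int m"
        by (simp add: g_def field_simps)
      then show ?thesis by simp
    qed
    then show "to_torus (g t) = \<gamma> t" by (simp add: y to_torus_eq_iff)
  qed
qed

text \<open>The lift witnessing a velocity may depend on \<open>t\<close> and jump elsewhere. Its
  difference \<open>D\<close> from the continuous lift is integral and continuous at
  \<open>t\<close>, hence constant near \<open>t\<close>; so a single continuous lift has all the
  velocities as derivatives.\<close>

lemma has_velocity_lift:
  assumes g: "continuous_on {0..1} g" "\<And>s. s \<in> {0..1} \<Longrightarrow> to_torus (g s) = \<gamma> s"
    and v: "has_velocity \<gamma> v t" and t: "t \<in> {0..1}"
  shows "(g has_vector_derivative v) (at t within {0..1})"
proof -
  obtain h where h: "\<And>s. s \<in> {0..1} \<Longrightarrow> to_torus (h s) = \<gamma> s"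
      "(h has_vector_derivative v) (at t within {0..1})"
    using v unfolding has_velocity_def by blast
  define D where "D s = g s - h s" for s
  have int: "D s $ i \<in> \<int>" if "s \<in> {0..1}" for s i
    using g(2)[OF that] h(1)[OF that] by (metis D_def to_torus_eq_iff vector_minus_component)
  have "continuous (at t within {0..1}) D"
    unfolding D_def
    by (intro continuous_diff has_vector_derivative_continuous[OF h(2)])
      (use g(1) t in \<open>auto simp: continuous_on_eq_continuous_within\<close>)
  then obtain d where d: "d > 0" "\<And>s. s \<in> {0..1} \<Longrightarrow> dist s t < d \<Longrightarrow> dist (D s) (D t) < 1"
    unfolding continuous_within_eps_delta using zero_less_one by blast
  have const: "D s = D t" if s: "s \<in> {0..1}" "dist s t < d" for s
  proof -
    have "D s $ i = D t $ i" for i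
    proof -
      have "D s $ i - D t $ i \<in> \<int>"
        using int s(1) t by simp
      moreover have "\<bar>D s $ i - D t $ i\<bar> < 1"
        using d(2)[OF s] component_le_norm_cart[of "D s - D t" i] by (simp add: dist_norm)
      ultimately show ?thesis
        using Ints_nonzero_abs_less1 by force
    qed
    then show ?thesis by (simp add: vec_eq_iff)
  qed
  have "((\<lambda>s. h s + D t) has_vector_derivative v) (at t within {0..1})"
    using has_vector_derivative_add[OF h(2) has_vector_derivative_const] by simp
  then show ?thesis
  proof (rule has_vector_derivative_transform_within[OF _ d(1) t])
    fix s :: real assume "s \<in> {0..1}" "dist s t < d"
    from const[OF this] show "h s + D t = g s" by (simp add: D_def algebra_simps)
  qed
qed

lemma velocity_eqI: "has_velocity \<gamma> v t \<Longrightarrow> t \<in> {0..1} \<Longrightarrow> velocity \<gamma> t = v"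
  unfolding velocity_def by (rule the_equality) (auto dest: has_velocity_unique)

section \<open>Arc length and displacement along a rectifiable curve\<close>

definition arc_length :: "(real \<Rightarrow> ('d::finite) torus) \<Rightarrow> real \<Rightarrow> real" where
  "arc_length \<gamma> t = integral {0..t} (\<lambda>s. norm (velocity \<gamma> s))"

text \<open>Finite length, made explicit because the Bochner integral gives a non-integrable speed
  the value 0.\<close>

definition rectifiable :: "(real \<Rightarrow> ('d::finite) torus) \<Rightarrow> bool" where
  "rectifiable \<gamma> \<longleftrightarrow> set_integrable lebesgue {0..1} (\<lambda>s. norm (velocity \<gamma> s))"

lemma arc_length_0 [simp]: "arc_length \<gamma> 0 = 0"
  by (simp add: arc_length_def)

context
  fixes \<gamma> :: "real \<Rightarrow> ('d::finite) torus"
  assumes rect: "rectifiable \<gamma>"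
begin

lemma speed_integrable_subinterval:
  assumes "0 \<le> a" "b \<le> 1"
  shows "set_integrable lebesgue {a..b} (\<lambda>s. norm (velocity \<gamma> s))"
  using rect unfolding rectifiable_def
  by (rule absolutely_integrable_on_subinterval) (use assms in auto)

lemma speed_integrable_on:
  assumes "0 \<le> a" "b \<le> 1"
  shows "(\<lambda>s. norm (velocity \<gamma> s)) integrable_on {a..b}"
  using speed_integrable_subinterval[OF assms] by (rule set_lebesgue_integral_eq_integral)

lemma curve_length_eq_arc_length: "curve_length \<gamma> = arc_length \<gamma> 1"
  using set_lebesgue_integral_eq_integral(2)[OF speed_integrable_subinterval[of 0 1]]
  by (simp add: curve_length_def curve_integral_def arc_length_def)

lemma integral_speed:
  assumes "0 \<le> a" "a \<le> b" "b \<le> 1"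
  shows "integral {a..b} (\<lambda>s. norm (velocity \<gamma> s)) = arc_length \<gamma> b - arc_length \<gamma> a"
  unfolding arc_length_def
  using Henstock_Kurzweil_Integration.integral_combine[OF assms(1,2) speed_integrable_on] assms
  by (simp add: algebra_simps)

lemma arc_length_mono:
  assumes "0 \<le> a" "a \<le> b" "b \<le> 1"
  shows "arc_length \<gamma> a \<le> arc_length \<gamma> b"
proof -
  have "0 \<le> integral {a..b} (\<lambda>s. norm (velocity \<gamma> s))"
    by (rule integral_nonneg[OF speed_integrable_on]) (use assms in auto)
  then show ?thesis using integral_speed[OF assms] by simp
qed

lemma continuous_on_arc_length: "continuous_on {0..1} (arc_length \<gamma>)"
  unfolding arc_length_def[abs_def]
  by (rule indefinite_integral_continuous_1[OF speed_integrable_on]) auto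

text \<open>Intermediate values of the continuous arc length; the second search starts at
  \<open>p\<close>, which yields \<open>p \<le> q\<close>.\<close>

lemma arc_with_lengths:
  assumes "0 \<le> \<alpha>" "\<alpha> \<le> \<beta>" "\<beta> \<le> arc_length \<gamma> 1"
  obtains p q where "0 \<le> p" "p \<le> q" "q \<le> 1" "arc_length \<gamma> p = \<alpha>" "arc_length \<gamma> q = \<beta>"
proof -
  obtain p where p: "0 \<le> p" "p \<le> 1" "arc_length \<gamma> p = \<alpha>"
    using IVT'[of "arc_length \<gamma>" 0 \<alpha> 1] assms continuous_on_arc_length by auto
  obtain q where q: "p \<le> q" "q \<le> 1" "arc_length \<gamma> q = \<beta>"
    using IVT'[of "arc_length \<gamma>" p \<beta> 1] assms p
      continuous_on_subset[OF continuous_on_arc_length, of "{p..1}"] by auto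
  show ?thesis using that p q by blast
qed

text \<open>Arc length is read on a circle of circumference \<open>arc_length \<gamma> 1\<close>;
  the second alternative measures the way through the base point. \<open>E\<close> is the preimage
  of a window of radius \<open>r\<close> about \<open>c\<close>, and
  \<open>2 * r \<le> arc_length \<gamma> 1\<close> keeps the window from overlapping itself.\<close>

lemma arc_around:
  assumes c: "0 \<le> c" "c \<le> arc_length \<gamma> 1" and r: "0 \<le> r" "2 * r \<le> arc_length \<gamma> 1"
  obtains E where "E \<subseteq> {0..1}" "E \<in> sets lebesgue"
    "(LINT s:E|lebesgue. norm (velocity \<gamma> s)) = 2 * r"
    "\<And>s. s \<in> E \<Longrightarrow> \<bar>arc_length \<gamma> s - c\<bar> \<le> r \<or> arc_length \<gamma> 1 - \<bar>arc_length \<gamma> s - c\<bar> \<le> r"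
proof -
  let ?l = "arc_length \<gamma> 1"
  let ?v = "\<lambda>s. norm (velocity \<gamma> s)"
  note arc = that
  have LINT: "(LINT s:{a..b}|lebesgue. ?v s) = arc_length \<gamma> b - arc_length \<gamma> a"
    if "0 \<le> a" "a \<le> b" "b \<le> 1" for a b
    using set_lebesgue_integral_eq_integral(2)[OF speed_integrable_subinterval] integral_speed that
    by simp
  \<comment> \<open>the case of an arc that runs across the common start and end point of the curve\<close>
  have two: ?thesis if *: "0 \<le> \<beta>" "\<beta> \<le> \<alpha>" "\<alpha> \<le> ?l" "\<beta> + ?l - \<alpha> = 2 * r"
    and win: "\<And>u. 0 \<le> u \<Longrightarrow> u \<le> \<beta> \<Longrightarrow> \<bar>u - c\<bar> \<le> r \<or> ?l - \<bar>u - c\<bar> \<le> r"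
      "\<And>u. \<alpha> \<le> u \<Longrightarrow> u \<le> ?l \<Longrightarrow> \<bar>u - c\<bar> \<le> r \<or> ?l - \<bar>u - c\<bar> \<le> r" for \<alpha> \<beta>
  proof -
    obtain q p where pq: "0 \<le> q" "q \<le> p" "p \<le> 1" "arc_length \<gamma> q = \<beta>" "arc_length \<gamma> p = \<alpha>"
      using arc_with_lengths[of \<beta> \<alpha>] *(1-3) by metis
    have 1: "(LINT s:{0..q} \<union> {p..1}|lebesgue. ?v s) = (LINT s:{0..q}|lebesgue. ?v s) + (LINT s:{p..1}|lebesgue. ?v s)"
    proof (rule set_integral_Un_AE)
      \<comment> \<open>The two intervals can meet only if \<open>q = p\<close>, and then in that
        single point.\<close>
      show "AE s in lebesgue. \<not> (s \<in> {0..q} \<and> s \<in> {p..1})"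
      proof (rule AE_I')
        show "{p} \<in> null_sets lebesgue" by simp
      qed (use pq in auto)
    qed (use pq in \<open>auto intro!: speed_integrable_subinterval\<close>)
    show ?thesis
    proof (rule arc[of "{0..q} \<union> {p..1}"])
      show "{0..q} \<union> {p..1} \<subseteq> {0..1}" using pq by auto
      show "(LINT s:{0..q} \<union> {p..1}|lebesgue. ?v s) = 2 * r"
        using 1 pq *(4) by (simp add: LINT)
      fix s assume "s \<in> {0..q} \<union> {p..1}"
      then show "\<bar>arc_length \<gamma> s - c\<bar> \<le> r \<or> ?l - \<bar>arc_length \<gamma> s - c\<bar> \<le> r"
        using win[of "arc_length \<gamma> s"] arc_length_mono[of 0 s] arc_length_mono[of s q] arc_length_mono[of p s]
          arc_length_mono[of s 1] pq by auto
    qed auto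
  qed
  \<comment> \<open>The window sticks out before the start, sticks out beyond the end, or lies
    inside.\<close>
  consider "c < r" | "c > ?l - r" | "r \<le> c" "c \<le> ?l - r" by linarith
  then show ?thesis
  proof cases
    case 1
    show ?thesis
      by (rule two[of "c + r" "c - r + ?l"]) (use 1 c r in auto)
  next
    case 2
    show ?thesis
      by (rule two[of "c + r - ?l" "c - r"]) (use 2 c r in auto)
  next
    case 3
    obtain p q where pq: "0 \<le> p" "p \<le> q" "q \<le> 1" "arc_length \<gamma> p = c - r" "arc_length \<gamma> q = c + r"
      using arc_with_lengths[of "c - r" "c + r"] 3 r by auto
    show ?thesis
    proof (rule that[of "{p..q}"])
      show "(LINT s:{p..q}|lebesgue. ?v s) = 2 * r"
        using LINT pq by simp
      fix s assume "s \<in> {p..q}"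
      then show "\<bar>arc_length \<gamma> s - c\<bar> \<le> r \<or> ?l - \<bar>arc_length \<gamma> s - c\<bar> \<le> r"
        using arc_length_mono[of p s] arc_length_mono[of s q] pq by auto
    qed (use pq in auto)
  qed
qed

text \<open>The fundamental theorem of calculus tolerates finitely many exceptional points for the
  continuous lift, and the norm of the integral of the velocity is at most the integral of the
  speed.\<close>

lemma norm_lift_diff_le:
  assumes diff: "piecewise_differentiable_curve \<gamma>"
    and g: "continuous_on {0..1} g" "\<And>t. t \<in> {0..1} \<Longrightarrow> to_torus (g t) = \<gamma> t"
    and st: "0 \<le> s" "s \<le> t" "t \<le> 1"
  shows "norm (g t - g s) \<le> arc_length \<gamma> t - arc_length \<gamma> s"
proof -
  obtain S where S: "finite S" "\<And>u. u \<in> {0..1} - S \<Longrightarrow> \<exists>v. has_velocity \<gamma> v u"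
    using diff unfolding piecewise_differentiable_curve_def by blast
  have deriv: "(g has_vector_derivative velocity \<gamma> u) (at u)" if u: "u \<in> {s<..<t} - S" for u
  proof -
    obtain v where v: "has_velocity \<gamma> v u" using S(2)[of u] u st by auto
    have "(g has_vector_derivative v) (at u within {0..1})"
      by (rule has_velocity_lift[OF g v]) (use u st in auto)
    moreover have "at u within {0..1} = at u"
      by (rule at_within_interior) (use u st in auto)
    ultimately show ?thesis
      using velocity_eqI[OF v] u st by simp
  qed
  have "(velocity \<gamma> has_integral (g t - g s)) {s..t}"
    by (rule fundamental_theorem_of_calculus_interior_strong[OF S(1) st(2) deriv])
      (use st in \<open>auto intro: continuous_on_subset[OF g(1)]\<close>)
  then have "norm (g t - g s) \<le> integral {s..t} (\<lambda>u. norm (velocity \<gamma> u))"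
    using integral_norm_bound_integral[of "velocity \<gamma>" "{s..t}" "\<lambda>u. norm (velocity \<gamma> u)"]
      speed_integrable_on[of s t] st by (auto simp: integral_unique has_integral_integrable)
  then show ?thesis using integral_speed st by simp
qed

text \<open>Either of the two arcs joining the points bounds their displacement. Representatives
  appear in the conclusion because the kernel estimate needs the Euclidean norm, whereas
  \<open>dist\<close> comes from the maximum norm.\<close>

lemma closed_curve_displacement:
  assumes "path \<gamma>" "pathfinish \<gamma> = pathstart \<gamma>" "piecewise_differentiable_curve \<gamma>"
    and st: "s \<in> {0..1}" "t \<in> {0..1}"
    and d: "d = \<bar>arc_length \<gamma> s - arc_length \<gamma> t\<bar> \<or> d = arc_length \<gamma> 1 - \<bar>arc_length \<gamma> s - arc_length \<gamma> t\<bar>"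
  obtains x y where "\<gamma> s = to_torus x" "\<gamma> t = to_torus y" "norm (x - y) \<le> d"
proof -
  obtain g where g: "continuous_on {0..1} g" "\<And>t. t \<in> {0..1} \<Longrightarrow> to_torus (g t) = \<gamma> t"
    using lift_curve assms(1) by blast
  note le = norm_lift_diff_le[OF assms(3) g]
  have per: "g 1 - g 0 \<in> int_vecs"
    using assms(2) g(2)[of 0] g(2)[of 1]
    by (simp add: pathfinish_def pathstart_def int_vecs_def flip: to_torus_eq_iff)
  have "\<exists>x y. \<gamma> s = to_torus x \<and> \<gamma> t = to_torus y \<and> norm (x - y) \<le> d"
    if st: "s \<in> {0..1}" "t \<in> {0..1}" "s \<le> t"
      and d: "d = arc_length \<gamma> t - arc_length \<gamma> s \<or> d = arc_length \<gamma> 1 - (arc_length \<gamma> t - arc_length \<gamma> s)"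
    for s t
    using d
  proof
    assume "d = arc_length \<gamma> t - arc_length \<gamma> s"
    then show ?thesis
      using le[of s t] st g(2) by (intro exI[of _ "g s"] exI[of _ "g t"]) (auto simp: norm_minus_commute)
  next
    assume d: "d = arc_length \<gamma> 1 - (arc_length \<gamma> t - arc_length \<gamma> s)"
    \<comment> \<open>Since the curve is closed, shifting \<open>g s\<close> by the integer vector
      \<open>g 1 - g 0\<close> gives another representative of \<open>\<gamma> s\<close>, reached
      from \<open>g t\<close> through the base point.\<close>
    have "norm (g s + (g 1 - g 0) - g t) \<le> norm (g s - g 0) + norm (g 1 - g t)"
      using norm_triangle_ineq[of "g s - g 0" "g 1 - g t"] by (simp add: algebra_simps)
    also have "\<dots> \<le> d"
      using le[of 0 s] le[of t 1] st d by simp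
    finally show ?thesis
      using g(2) st by (intro exI[of _ "g s + (g 1 - g 0)"] exI[of _ "g t"])
        (simp add: to_torus_add_int_vecs per)
  qed
  note * = this
  show ?thesis
  proof (cases "s \<le> t")
    case True
    then show ?thesis
      using *[of s t] d st arc_length_mono[of s t] that by fastforce
  next
    case False
    then obtain x y where "\<gamma> t = to_torus x" "\<gamma> s = to_torus y" "norm (x - y) \<le> d"
      using *[of t s] d st arc_length_mono[of t s] by fastforce
    then show ?thesis
      using that[of y x] by (simp add: norm_minus_commute)
  qed
qed

end

section \<open>The Dirichlet kernel\<close>

text \<open>The frequencies form a box, so this is the distributive law.\<close>

lemma sum_freqs_prod:
  fixes f :: "'d::finite \<Rightarrow> int \<Rightarrow> 'a::comm_semiring_1"
  shows "(\<Sum>k\<in>freqs n. \<Prod>l\<in>UNIV. f l (k $ l)) = (\<Prod>l\<in>UNIV. \<Sum>m\<in>{- int n..int n}. f l m)"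
proof -
  have "(\<Prod>l\<in>UNIV. \<Sum>m\<in>{- int n..int n}. f l m) =
      (\<Sum>g\<in>UNIV \<rightarrow>\<^sub>E {- int n..int n}. \<Prod>l\<in>UNIV. f l (g l))"
    by (rule prod_sum_PiE) auto
  also have "\<dots> = (\<Sum>k\<in>freqs n. \<Prod>l\<in>UNIV. f l (k $ l))"
    by (rule sum.reindex_bij_witness[of _ vec_nth vec_lambda])
      (auto simp: freqs_def PiE_iff abs_le_iff minus_le_iff)
  finally show ?thesis ..
qed

lemma card_freqs: "card (freqs n :: (int ^ 'd) set) = (2 * n + 1) ^ CARD('d::finite)"
  using sum_freqs_prod[of "\<lambda>(_ :: 'd) _. 1 :: nat" n]
  by (simp add: nat_add_distrib nat_mult_distrib)

lemma sum_symmetric_interval: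
  "(\<Sum>m\<in>{- int n..int n}. real_of_int m) = 0"
  "(\<Sum>m\<in>{- int n..int n}. (real_of_int m)\<^sup>2) = real n * (real n + 1) * (2 * real n + 1) / 3"
proof -
  have "(\<Sum>m\<in>{- int n..int n}. real_of_int m) = 0 \<and>
    (\<Sum>m\<in>{- int n..int n}. (real_of_int m)\<^sup>2) = real n * (real n + 1) * (2 * real n + 1) / 3"
  proof (induction n)
    case (Suc n)
    have "{- int (Suc n)..int (Suc n)} = insert (int (Suc n)) (insert (- int (Suc n)) {- int n..int n})"
      by auto
    then show ?case using Suc
      by (simp add: power2_eq_square field_simps)
  qed simp
  then show "(\<Sum>m\<in>{- int n..int n}. real_of_int m) = 0"
    "(\<Sum>m\<in>{- int n..int n}. (real_of_int m)\<^sup>2) = real n * (real n + 1) * (2 * real n + 1) / 3"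
    by blast+
qed

text \<open>The sum factorises over the coordinates. For \<open>i \<noteq> j\<close> the factor at
  \<open>i\<close> is the sum of an odd function over a symmetric interval; for \<open>i = j\<close>
  one factor is a sum of squares and the others count.\<close>

lemma sum_freqs_mult_components:
  fixes i j :: "'d::finite"
  shows "(\<Sum>k\<in>freqs n. real_of_int (k $ i) * real_of_int (k $ j)) =
    (if i = j then (2 * real n + 1) ^ CARD('d) * (real n * (real n + 1) / 3) else 0)"
proof -
  define f where "f l m = (if l = i then real_of_int m else 1) * (if l = j then real_of_int m else 1)"
    for l :: 'd and m
  have "(\<Sum>k\<in>freqs n. real_of_int (k $ i) * real_of_int (k $ j)) =
      (\<Sum>k\<in>freqs n. \<Prod>l\<in>UNIV. f l (k $ l))"
    by (simp add: f_def prod.distrib)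
  also have "\<dots> = (\<Prod>l\<in>UNIV. \<Sum>m\<in>{- int n..int n}. f l m)"
    by (rule sum_freqs_prod)
  also have "\<dots> = (\<Sum>m\<in>{- int n..int n}. f i m) * (\<Prod>l\<in>UNIV - {i}. \<Sum>m\<in>{- int n..int n}. f l m)"
    by (rule prod.remove) auto
  also have "\<dots> = (if i = j then (2 * real n + 1) ^ CARD('d) * (real n * (real n + 1) / 3) else 0)"
  proof (cases "i = j")
    case True
    have "(\<Prod>l\<in>UNIV - {i}. \<Sum>m\<in>{- int n..int n}. f l m) = (\<Prod>l\<in>UNIV - {i}. 2 * real n + 1)"
      using True by (intro prod.cong) (auto simp: f_def)
    also have "\<dots> = (2 * real n + 1) ^ (CARD('d) - 1)"
      by (simp add: card_Diff_singleton)
    finally have *: "(\<Prod>l\<in>UNIV - {i}. \<Sum>m\<in>{- int n..int n}. f l m) = \<dots>" .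
    have "(2 * real n + 1) ^ CARD('d) = (2 * real n + 1) * (2 * real n + 1) ^ (CARD('d) - 1)"
      by (metis Suc_pred' power_Suc zero_less_card_finite)
    then show ?thesis
      using True sum_symmetric_interval(2)[of n]
      unfolding * by (simp add: f_def power2_eq_square)
  next
    case False
    then show ?thesis by (simp add: f_def sum_symmetric_interval)
  qed
  finally show ?thesis .
qed

text \<open>The second moment matrix of the frequencies is a multiple of the identity, so its
  quadratic form is a multiple of the squared norm.\<close>

lemma sum_freqs_linear_form_squared:
  fixes z :: "real ^ 'd::finite"
  shows "(\<Sum>k\<in>freqs n. (\<Sum>i\<in>UNIV. real_of_int (k $ i) * z $ i)\<^sup>2) =
    (2 * real n + 1) ^ CARD('d) * (real n * (real n + 1) / 3) * (norm z)\<^sup>2"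
proof -
  define M where "M = (2 * real n + 1) ^ CARD('d) * (real n * (real n + 1) / 3)"
  have "(\<Sum>k\<in>freqs n. (\<Sum>i\<in>UNIV. real_of_int (k $ i) * z $ i)\<^sup>2) =
    (\<Sum>k\<in>freqs n. \<Sum>i\<in>UNIV. \<Sum>j\<in>UNIV. z $ i * z $ j * (real_of_int (k $ i) * real_of_int (k $ j)))"
    unfolding power2_eq_square sum_product by (intro sum.cong refl) (simp only: mult_ac)
  also have "\<dots> = (\<Sum>i\<in>UNIV. \<Sum>k\<in>freqs n. \<Sum>j\<in>UNIV. z $ i * z $ j * (real_of_int (k $ i) * real_of_int (k $ j)))"
    by (rule sum.swap)
  also have "\<dots> = (\<Sum>i\<in>UNIV. \<Sum>j\<in>UNIV. \<Sum>k\<in>freqs n. z $ i * z $ j * (real_of_int (k $ i) * real_of_int (k $ j)))"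
    by (rule sum.cong[OF refl sum.swap])
  also have "\<dots> = (\<Sum>i\<in>UNIV. z $ i * z $ i * M)"
  proof (rule sum.cong[OF refl])
    fix i
    have "(\<Sum>j\<in>UNIV. \<Sum>k\<in>freqs n. z $ i * z $ j * (real_of_int (k $ i) * real_of_int (k $ j))) =
        (\<Sum>j\<in>UNIV. z $ i * z $ j * (if i = j then M else 0))"
      unfolding M_def sum_distrib_left[symmetric] sum_freqs_mult_components ..
    also have "\<dots> = (\<Sum>j\<in>UNIV. if i = j then z $ i * z $ i * M else 0)"
      by (intro sum.cong refl) simp
    finally show "(\<Sum>j\<in>UNIV. \<Sum>k\<in>freqs n. z $ i * z $ j * (real_of_int (k $ i) * real_of_int (k $ j))) =
        z $ i * z $ i * M"
      by simp
  qed
  also have "\<dots> = M * (z \<bullet> z)"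
    unfolding inner_vec_def inner_real_def by (subst sum_distrib_right[symmetric]) (rule mult.commute)
  finally show ?thesis by (simp only: power2_norm_eq_inner M_def)
qed

definition dirichlet_kernel :: "nat \<Rightarrow> ('d::finite) torus \<Rightarrow> 'd torus \<Rightarrow> complex" where
  "dirichlet_kernel n x y = (\<Sum>k\<in>freqs n. torus_char k x * cnj (torus_char k y))"

lemma cos_ge_one_minus_half_square: "1 - x\<^sup>2 / 2 \<le> cos (x :: real)"
proof -
  have "cos x = 1 - 2 * (sin (x / 2))\<^sup>2" using cos_double_sin[of "x / 2"] by simp
  moreover have "(sin (x / 2))\<^sup>2 \<le> (x / 2)\<^sup>2"
    using abs_sin_x_le_abs_x[of "x / 2"] by (simp only: abs_le_square_iff)
  ultimately show ?thesis by (simp add: power_divide)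
qed

text \<open>The quadratic bound for the cosine is summed over all frequencies. The estimate holds
  for every choice of representatives, although only its right side is periodic.\<close>

lemma Re_dirichlet_kernel_ge:
  fixes u v :: "real ^ 'd::finite"
  shows "(2 * real n + 1) ^ CARD('d) * (1 - 2 * pi\<^sup>2 * real n * (real n + 1) / 3 * (norm (u - v))\<^sup>2)
    \<le> Re (dirichlet_kernel n (to_torus u) (to_torus v))"
proof -
  let ?s = "\<lambda>k :: int ^ 'd. \<Sum>i\<in>UNIV. real_of_int (k $ i) * (u - v) $ i"
  have aux: "(2 * pi * x)\<^sup>2 / 2 = 2 * pi\<^sup>2 * x\<^sup>2" for x :: real
    by (simp add: power_mult_distrib)
  have "(2 * real n + 1) ^ CARD('d) * (1 - 2 * pi\<^sup>2 * real n * (real n + 1) / 3 * (norm (u - v))\<^sup>2)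
    = real (card (freqs n :: (int ^ 'd) set)) - 2 * pi\<^sup>2 * (\<Sum>k\<in>freqs n. (?s k)\<^sup>2)"
    unfolding sum_freqs_linear_form_squared card_freqs by (simp add: algebra_simps)
  also have "\<dots> = (\<Sum>k\<in>freqs n. 1 - (2 * pi * ?s k)\<^sup>2 / 2)"
    unfolding aux sum_subtractf by (subst sum_distrib_left) simp
  also have "\<dots> \<le> (\<Sum>k\<in>freqs n. cos (2 * pi * ?s k))"
    by (intro sum_mono cos_ge_one_minus_half_square)
  also have "\<dots> = Re (dirichlet_kernel n (to_torus u) (to_torus v))"
    unfolding dirichlet_kernel_def torus_char_to_torus_mult_cnj by simp
  finally show ?thesis .
qed

text \<open>With \<open>M\<close> the value on the diagonal, \<open>(R - M)\<^sup>2 \<ge> 0\<close>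
  gives \<open>R\<^sup>2 \<ge> 2 * M * R - M\<^sup>2\<close>. This turns the linear bound for
  \<open>R\<close> into one for its square even where \<open>1 - q\<close> is negative.\<close>

lemma norm_dirichlet_kernel_squared_ge:
  fixes u v :: "real ^ 'd::finite"
  shows "((2 * real n + 1) ^ CARD('d))\<^sup>2 * (1 - 4 * pi\<^sup>2 * real n * (real n + 1) / 3 * (norm (u - v))\<^sup>2)
    \<le> (cmod (dirichlet_kernel n (to_torus u) (to_torus v)))\<^sup>2"
proof -
  define M where "M = (2 * real n + 1) ^ CARD('d)"
  define q where "q = 2 * pi\<^sup>2 * real n * (real n + 1) / 3 * (norm (u - v))\<^sup>2"
  define R where "R = Re (dirichlet_kernel n (to_torus u) (to_torus v))"
  have "M > 0" by (simp add: M_def)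
  have "M * (1 - q) \<le> R"
    using Re_dirichlet_kernel_ge[of n u v] by (simp add: M_def q_def R_def)
  then have "M * (M * (1 - q)) \<le> M * R"
    using \<open>M > 0\<close> by (intro mult_left_mono) auto
  moreover have "0 \<le> (R - M)\<^sup>2" by simp
  ultimately have "M\<^sup>2 * (1 - 2 * q) \<le> R\<^sup>2"
    by (simp add: power2_eq_square algebra_simps)
  also have "\<dots> \<le> (cmod (dirichlet_kernel n (to_torus u) (to_torus v)))\<^sup>2"
    unfolding R_def by (simp add: cmod_power2)
  finally show ?thesis by (simp add: M_def q_def algebra_simps)
qed

text \<open>Expanding the kernel times its conjugate separates \<open>x\<close> from
  \<open>y\<close>, so integrating out \<open>x\<close> leaves a combination of characters in
  \<open>y\<close>.\<close>

lemma norm_dirichlet_kernel_squared: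
  "of_real ((cmod (dirichlet_kernel n x y))\<^sup>2) =
    (\<Sum>k\<in>freqs n. \<Sum>l\<in>freqs n. torus_char (k - l) x * torus_char (l - k) y)"
  unfolding complex_norm_square dirichlet_kernel_def cnj_sum sum_product
  by (intro sum.cong refl) (simp add: torus_char_diff)

section \<open>Closure properties of trigonometric polynomials\<close>

lemma zero_in_trig_polys: "(\<lambda>_. 0) \<in> trig_polys N"
  unfolding trig_polys_def by (auto intro: exI[of _ "\<lambda>_. 0"])

lemma add_in_trig_polys:
  assumes "f \<in> trig_polys N" "g \<in> trig_polys N"
  shows "(\<lambda>x. f x + g x) \<in> trig_polys N"
proof -
  obtain c d where "\<And>x. f x = (\<Sum>k\<in>freqs N. c k * torus_char k x)"
    "\<And>x. g x = (\<Sum>k\<in>freqs N. d k * torus_char k x)"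
    using assms unfolding trig_polys_def by blast
  then show ?thesis
    unfolding trig_polys_def by (auto intro!: exI[of _ "\<lambda>k. c k + d k"] simp: sum.distrib ring_distribs)
qed

lemma sum_in_trig_polys:
  assumes "\<And>i. i \<in> I \<Longrightarrow> f i \<in> trig_polys N"
  shows "(\<lambda>x. \<Sum>i\<in>I. f i x) \<in> trig_polys N"
  using assms
  by (induction I rule: infinite_finite_induct) (auto simp: zero_in_trig_polys add_in_trig_polys)

lemma torus_char_in_trig_polys:
  assumes "k \<in> freqs N"
  shows "(\<lambda>x. c * torus_char k x) \<in> trig_polys N"
proof -
  have "(\<Sum>l\<in>freqs N. (if l = k then c else 0) * torus_char l x) = c * torus_char k x" for x
    using assms by (simp add: if_distrib[of "\<lambda>c. c * _"] finite_freqs cong: if_cong)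
  then show ?thesis
    unfolding trig_polys_def by (intro CollectI exI[of _ "\<lambda>l. if l = k then c else 0"]) simp
qed

lemma freqs_diff: "k \<in> freqs n \<Longrightarrow> l \<in> freqs n \<Longrightarrow> k - l \<in> freqs (2 * n)"
  unfolding freqs_def
proof (clarsimp)
  fix i assume "\<forall>i. \<bar>k $ i\<bar> \<le> int n" "\<forall>i. \<bar>l $ i\<bar> \<le> int n"
  then have "\<bar>k $ i\<bar> \<le> int n" "\<bar>l $ i\<bar> \<le> int n" by blast+
  then show "\<bar>k $ i - l $ i\<bar> \<le> 2 * int n" by linarith
qed

section \<open>Integrals along a curve\<close>

text \<open>A continuous function on a compact interval is bounded and measurable, so it preserves
  absolute integrability. It serves with the speed and with the weighted speed as
  \<open>\<phi>\<close>.\<close>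

lemma set_integrable_scaleR_continuous:
  fixes h :: "real \<Rightarrow> 'b::euclidean_space"
  assumes "set_integrable lebesgue {0..1} \<phi>" "continuous_on {0..1} h"
  shows "set_integrable lebesgue {0..1} (\<lambda>t. \<phi> t *\<^sub>R h t)"
proof (rule absolutely_integrable_bounded_measurable_product[where f = h and g = \<phi>])
  show "bilinear (\<lambda>x c. c *\<^sub>R x :: 'b)"
    by (auto simp: bilinear_def intro!: linearI simp: algebra_simps)
  show "h \<in> borel_measurable (lebesgue_on {0..1})"
    using assms(2) by (rule continuous_imp_measurable_on_sets_lebesgue) auto
  show "bounded (h ` {0..1})"
    by (intro compact_imp_bounded compact_continuous_image assms) auto
qed (use assms in auto)

context
  fixes \<gamma> :: "real \<Rightarrow> ('d::finite) torus"
  assumes path: "path \<gamma>" and rect: "rectifiable \<gamma>"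
begin

lemma continuous_on_torus_char_curve: "continuous_on {0..1} (\<lambda>t. torus_char k (\<gamma> t))"
  using path unfolding path_def
  by (rule continuous_on_compose2[OF continuous_on_torus_char[of UNIV]]) auto

lemma curve_integral_norm_dirichlet_kernel:
  "of_real (curve_integral \<gamma> (\<lambda>x. (cmod (dirichlet_kernel n x y))\<^sup>2)) =
   (\<Sum>k\<in>freqs n. \<Sum>l\<in>freqs n. curve_integral \<gamma> (torus_char (k - l)) * torus_char (l - k) y)"
proof -
  have int: "set_integrable lebesgue {0..1} (\<lambda>t. norm (velocity \<gamma> t) *\<^sub>R torus_char k (\<gamma> t))" for k
    by (rule set_integrable_scaleR_continuous[OF rect[unfolded rectifiable_def] continuous_on_torus_char_curve])
  have "of_real (curve_integral \<gamma> (\<lambda>x. (cmod (dirichlet_kernel n x y))\<^sup>2)) =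
     (LINT t:{0..1}|lebesgue. norm (velocity \<gamma> t) *\<^sub>R complex_of_real ((cmod (dirichlet_kernel n (\<gamma> t) y))\<^sup>2))"
    unfolding curve_integral_def
    by (subst set_integral_complex_of_real[symmetric]) (simp add: scaleR_conv_of_real)
  also have "\<dots> = (LINT t:{0..1}|lebesgue. \<Sum>k\<in>freqs n. \<Sum>l\<in>freqs n.
      norm (velocity \<gamma> t) *\<^sub>R torus_char (k - l) (\<gamma> t) * torus_char (l - k) y)"
    unfolding norm_dirichlet_kernel_squared by (simp add: scaleR_sum_right)
  also have "\<dots> = (\<Sum>k\<in>freqs n. \<Sum>l\<in>freqs n. curve_integral \<gamma> (torus_char (k - l)) * torus_char (l - k) y)"
    using int unfolding curve_integral_def set_lebesgue_integral_def set_integrable_def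
    by (simp add: scaleR_sum_right Bochner_Integration.integral_sum flip: mult_scaleR_left)
  finally show ?thesis .
qed

text \<open>On the arc of length \<open>2 * r\<close> around \<open>y\<close> the kernel is bounded
  below by its displacement estimate; the rest of the curve contributes a non-negative
  amount.\<close>

lemma curve_integral_norm_dirichlet_kernel_ge:
  assumes closed: "pathfinish \<gamma> = pathstart \<gamma>" and diff: "piecewise_differentiable_curve \<gamma>"
    and y: "y \<in> path_image \<gamma>"
    and r: "0 \<le> r" "2 * r \<le> curve_length \<gamma>"
  shows "((2 * real n + 1) ^ CARD('d))\<^sup>2 * (1 - 4 * pi\<^sup>2 * real n * (real n + 1) / 3 * r\<^sup>2) * (2 * r)
    \<le> curve_integral \<gamma> (\<lambda>x. (cmod (dirichlet_kernel n x y))\<^sup>2)"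
proof -
  define C where "C = ((2 * real n + 1) ^ CARD('d))\<^sup>2 * (1 - 4 * pi\<^sup>2 * real n * (real n + 1) / 3 * r\<^sup>2)"
  let ?v = "\<lambda>s. norm (velocity \<gamma> s)"
  let ?F = "\<lambda>s. (cmod (dirichlet_kernel n (\<gamma> s) y))\<^sup>2"
  obtain t where t: "t \<in> {0..1}" "y = \<gamma> t"
    using y unfolding path_image_def by blast
  have At: "0 \<le> arc_length \<gamma> t" "arc_length \<gamma> t \<le> arc_length \<gamma> 1"
    using arc_length_mono[OF rect, of 0 t] arc_length_mono[OF rect, of t 1] t by auto
  obtain E where E: "E \<subseteq> {0..1}" "E \<in> sets lebesgue" "(LINT s:E|lebesgue. ?v s) = 2 * r"
    "\<And>s. s \<in> E \<Longrightarrow> \<bar>arc_length \<gamma> s - arc_length \<gamma> t\<bar> \<le> r \<or>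
       arc_length \<gamma> 1 - \<bar>arc_length \<gamma> s - arc_length \<gamma> t\<bar> \<le> r"
    using arc_around[OF rect At r(1)] r(2) curve_length_eq_arc_length[OF rect] by metis
  have F_ge: "C \<le> ?F s" if s: "s \<in> E" for s
  proof -
    obtain d where d: "d \<le> r" "d = \<bar>arc_length \<gamma> s - arc_length \<gamma> t\<bar> \<or>
        d = arc_length \<gamma> 1 - \<bar>arc_length \<gamma> s - arc_length \<gamma> t\<bar>"
      using E(4)[OF s] by blast
    obtain x z where xz: "\<gamma> s = to_torus x" "\<gamma> t = to_torus z" "norm (x - z) \<le> d"
      using closed_curve_displacement[OF rect path closed diff _ t(1) d(2)] E(1) s by blast
    have "(norm (x - z))\<^sup>2 \<le> r\<^sup>2"
      using xz(3) d(1) by (intro power_mono) auto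
    then have "C \<le> ((2 * real n + 1) ^ CARD('d))\<^sup>2 *
        (1 - 4 * pi\<^sup>2 * real n * (real n + 1) / 3 * (norm (x - z))\<^sup>2)"
      unfolding C_def by (intro mult_left_mono diff_left_mono) auto
    also have "\<dots> \<le> ?F s"
      using norm_dirichlet_kernel_squared_ge[of n x z] xz t(2) by simp
    finally show ?thesis .
  qed
  have v_int: "set_integrable lebesgue E ?v"
    by (rule set_integrable_subset[OF rect[unfolded rectifiable_def] E(2,1)])
  have "continuous_on {0..1} ?F"
    unfolding dirichlet_kernel_def
    by (intro continuous_intros continuous_on_torus_char_curve)
  from set_integrable_scaleR_continuous[OF rect[unfolded rectifiable_def] this]
  have F_int: "set_integrable lebesgue {0..1} (\<lambda>s. ?v s *\<^sub>R ?F s)" .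
  have "C * (2 * r) = (LINT s:E|lebesgue. C * ?v s)"
    by (simp add: E(3))
  also have "\<dots> \<le> (LINT s:E|lebesgue. ?v s *\<^sub>R ?F s)"
  proof (rule set_integral_mono)
    show "set_integrable lebesgue E (\<lambda>s. ?v s *\<^sub>R ?F s)"
      by (rule set_integrable_subset[OF F_int E(2,1)])
    fix s assume "s \<in> E"
    then have "?v s * C \<le> ?v s * ?F s"
      by (intro mult_left_mono F_ge) auto
    then show "C * ?v s \<le> ?v s *\<^sub>R ?F s" by (simp add: mult.commute)
  qed (use v_int in auto)
  also have "\<dots> \<le> (LINT s:{0..1}|lebesgue. ?v s *\<^sub>R ?F s)"
    using F_int set_integrable_subset[OF F_int E(2,1)] E(1)
    unfolding set_lebesgue_integral_def set_integrable_def
    by (intro integral_mono) (auto simp: indicator_def)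
  finally show ?thesis
    by (simp add: C_def curve_integral_def)
qed

text \<open>The shorter arc to the starting point has length at most \<open>l / 2\<close>, so the
  whole curve stays within that distance of \<open>\<gamma> 0\<close>. The antipode \<open>b\<close>
  is at distance at least 1/2 from \<open>\<gamma> 0\<close>, hence at least
  \<open>1 / 2 - l / 2\<close> from the curve.\<close>

lemma closed_curve_length_ge:
  assumes closed: "pathfinish \<gamma> = pathstart \<gamma>" and diff: "piecewise_differentiable_curve \<gamma>"
  shows "1 - 2 * covering_radius (path_image \<gamma>) \<le> curve_length \<gamma>"
proof -
  define l where "l = curve_length \<gamma>"
  have near: "dist (\<gamma> t) (\<gamma> 0) \<le> l / 2" if t: "t \<in> {0..1}" for t
  proof -
    have *: "dist (\<gamma> t) (\<gamma> 0) \<le> d"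
      if d: "d = \<bar>arc_length \<gamma> t - arc_length \<gamma> 0\<bar> \<or> d = arc_length \<gamma> 1 - \<bar>arc_length \<gamma> t - arc_length \<gamma> 0\<bar>" for d
    proof -
      obtain x y where "\<gamma> t = to_torus x" "\<gamma> 0 = to_torus y" "norm (x - y) \<le> d"
        using closed_curve_displacement[OF rect path closed diff t _ d] by auto
      then show ?thesis using dist_to_torus_le[of x y] by simp
    qed
    \<comment> \<open>The two arcs have total length \<open>l\<close>, so adding both bounds gives
      twice the claim.\<close>
    from *[OF disjI1[OF refl]] *[OF disjI2[OF refl]] show ?thesis
      by (simp add: l_def curve_length_eq_arc_length[OF rect])
  qed
  obtain x where x: "\<gamma> 0 = to_torus x" using to_torus_surj by blast
  define b where "b = to_torus (x + (\<chi> i. 1 / 2))"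
  have half: "1 / 2 \<le> dist (\<gamma> 0) b"
  proof -
    have "1 / 2 \<le> infnorm (x - (x + (\<chi> i. 1 / 2)) + z)" if z: "z \<in> int_vecs" for z :: "real ^ 'd"
    proof -
      \<comment> \<open>One coordinate suffices: an integer is never closer than 1/2 to 1/2.\<close>
      fix i :: 'd
      obtain m :: int where "z $ i = of_int m"
        using z by (auto simp: int_vecs_def elim: Ints_cases)
      then have "\<bar>(x - (x + (\<chi> i. 1 / 2)) + z) $ i\<bar> = \<bar>of_int m - 1 / 2\<bar>" by simp
      moreover have "1 / 2 \<le> \<bar>real_of_int m - 1 / 2\<bar>"
        by (cases "m \<le> 0") auto
      ultimately show ?thesis
        using component_le_infnorm[of "x - (x + (\<chi> i. 1 / 2)) + z" i] by linarith
    qed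
    then show ?thesis
      unfolding x b_def dist_torus.abs_eq by (rule torus_pdist_greatest)
  qed
  have ne: "path_image \<gamma> \<noteq> {}" by simp
  have "1 / 2 - l / 2 \<le> (INF y\<in>path_image \<gamma>. dist y b)"
  proof (rule cINF_greatest[OF ne])
    fix y assume "y \<in> path_image \<gamma>"
    then obtain t where "t \<in> {0..1}" "y = \<gamma> t" unfolding path_image_def by blast
    then show "1 / 2 - l / 2 \<le> dist y b"
      using near[of t] half dist_triangle[of "\<gamma> 0" b y] by (simp add: dist_commute)
  qed
  also have "\<dots> \<le> covering_radius (path_image \<gamma>)"
    unfolding covering_radius_def by (rule cSUP_upper[OF UNIV_I bdd_above_covering_radius[OF ne]])
  finally show ?thesis by (simp add: l_def)
qed

end

section \<open>A numerical bound and the final estimate\<close>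

text \<open>Otherwise \<open>sin (3.17 / 6)\<close> would be below \<open>sin (pi / 6)\<close>,
  which is 1/2, but its cubic Taylor bound exceeds 1/2. The value 3.17 is just small enough for the
  constant 0.94 in dimension two.\<close>

lemma pi_le_317: "pi \<le> 3.17"
proof (rule ccontr)
  assume "\<not> ?thesis"
  then have "sin (3.17 / 6) < sin (pi / 6)"
    by (intro sin_monotone_2pi) auto
  moreover have "\<bar>sin (3.17 / 6) - 3.17 / 6\<bar> \<le> (3.17 / 6) ^ 3 / (6 :: real)"
    using Maclaurin_sin_bound[of "3.17 / 6" 3] by (simp add: eval_nat_numeral sin_coeff_def)
  ultimately show False
    by (simp add: sin_30 power3_eq_cube abs_le_iff)
qed

theorem theorem3p10:
  fixes \<gamma> :: "real \<Rightarrow> ('d::finite) torus" and w :: "'d torus \<Rightarrow> real" and n :: nat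
  assumes n: "n \<ge> 1"
    and continuous: "path \<gamma>"
    and closed_curve: "pathfinish \<gamma> = pathstart \<gamma>"
    and piecewise_diff: "piecewise_differentiable_curve \<gamma>"
    and self_inters: "finite (self_intersections \<gamma>)"
    and covering: "covering_radius (path_image \<gamma>) \<le> 1 / 8"
    and nonneg: "\<And>x. x \<in> path_image \<gamma> \<Longrightarrow> 0 \<le> w x"
    and measurable: "curve_measurable \<gamma> w"
    and quadrature: "\<And>f. f \<in> trig_polys (2 * n) \<Longrightarrow>
       of_real (1 / curve_length \<gamma>) * curve_integral \<gamma> (\<lambda>x. f x * of_real (w x))
       = (\<integral>x. f x \<partial>torus_measure)"
  shows "curve_length \<gamma> \<ge>
    0.94 / sqrt (2 * real CARD('d) + 1) * (2 * real n + 1) ^ (CARD('d) - 1)"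
proof -
  define l where "l = curve_length \<gamma>"
  define N where "N = 2 * real n + 1"
  have N: "N \<ge> 3" using n by (simp add: N_def)
  let ?v = "\<lambda>s. norm (velocity \<gamma> s)"
  have of_real_curve: "curve_integral \<gamma> (\<lambda>x. complex_of_real (f x)) = of_real (curve_integral \<gamma> f)" for f
    unfolding curve_integral_def
    by (subst set_integral_complex_of_real[symmetric]) (simp add: scaleR_conv_of_real)
  have real_quadrature: "1 / l * curve_integral \<gamma> (\<lambda>x. p x * w x) = c"
    if "(\<lambda>x. of_real (p x)) \<in> trig_polys (2 * n)" "(\<integral>x. of_real (p x) \<partial>torus_measure) = complex_of_real c" for p c
  proof -
    have "complex_of_real (1 / l * curve_integral \<gamma> (\<lambda>x. p x * w x)) = of_real c"
      using quadrature[OF that(1)] that(2)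
      by (simp add: l_def of_real_curve flip: of_real_mult)
    then show ?thesis by (simp only: of_real_eq_iff)
  qed
  have mass: "1 / l * curve_integral \<gamma> w = 1"
    using real_quadrature[of "\<lambda>_. 1" 1] torus_char_in_trig_polys[of 0 "2 * n" 1]
      integral_torus_char[of "0 :: int ^ 'd"] by (simp add: freqs_def)
  \<comment> \<open>Both the quotient \<open>1 / 0\<close> and the Bochner integral of a
    non-integrable function are 0, so total mass one forces the length to be nonzero and both
    integrands to be integrable.\<close>
  then have "l \<noteq> 0" and "curve_integral \<gamma> w \<noteq> 0" by auto
  then have rect: "rectifiable \<gamma>" and w_int: "set_integrable lebesgue {0..1} (\<lambda>s. ?v s *\<^sub>R w (\<gamma> s))"
    unfolding l_def curve_length_def curve_integral_def set_lebesgue_integral_def rectifiable_def set_integrable_def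
    using not_integrable_integral_eq by fastforce+
  have l_ge: "3 / 4 \<le> l"
    using closed_curve_length_ge[OF continuous rect closed_curve piecewise_diff] covering
    by (simp add: l_def)
  define p where "p y = curve_integral \<gamma> (\<lambda>x. (cmod (dirichlet_kernel n x y))\<^sup>2)" for y
  have p: "of_real (p y) = (\<Sum>k\<in>freqs n. \<Sum>l\<in>freqs n. curve_integral \<gamma> (torus_char (k - l)) * torus_char (l - k) y)" for y
    unfolding p_def by (rule curve_integral_norm_dirichlet_kernel[OF continuous rect])
  have p_trig: "(\<lambda>y. of_real (p y)) \<in> trig_polys (2 * n)"
    unfolding p by (intro sum_in_trig_polys torus_char_in_trig_polys freqs_diff)
  have char0: "curve_integral \<gamma> (torus_char 0) = of_real l"
    using of_real_curve[of "\<lambda>_. 1"] by (simp add: curve_length_def l_def curve_integral_def)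
  have char_int: "integrable torus_measure (torus_char k)" for k :: "int ^ 'd"
  proof -
    \<comment> \<open>The nonzero integral of the trivial character makes the constant 1 integrable,
      and it dominates every character.\<close>
    have "integral\<^sup>L torus_measure (torus_char (0 :: int ^ 'd)) \<noteq> 0"
      by (simp add: integral_torus_char del: torus_char_zero)
    then have "integrable torus_measure (torus_char (0 :: int ^ 'd))"
      using not_integrable_integral_eq by blast
    then show ?thesis
      by (rule Bochner_Integration.integrable_bound) (auto simp: torus_measure_def)
  qed
  \<comment> \<open>Only the terms with \<open>k = l\<close> survive; each contributes the length,
    and there are \<open>N ^ CARD('d)\<close> of them.\<close>
  have "(\<integral>y. of_real (p y) \<partial>torus_measure) =
      (\<Sum>k\<in>freqs n. \<Sum>l\<in>freqs n. curve_integral \<gamma> (torus_char (k - l)) * (if l - k = 0 then 1 else 0))"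
    unfolding p using char_int by (simp add: Bochner_Integration.integral_sum integral_torus_char)
  also have "\<dots> = (\<Sum>k\<in>(freqs n :: (int ^ 'd) set). of_real l)"
    by (intro sum.cong refl)
      (simp add: if_distrib[of "(*) _"] finite_freqs char0 cong: if_cong)
  also have "\<dots> = of_real (N ^ CARD('d) * l)"
    by (simp add: card_freqs N_def add.commute)
  finally have p_integral: "1 / l * curve_integral \<gamma> (\<lambda>x. p x * w x) = N ^ CARD('d) * l"
    by (intro real_quadrature p_trig)
  have main: "4 / (3 * pi) * N ^ (CARD('d) - 1) \<le> l"
  proof -
    \<comment> \<open>Up to constants the lower bound for \<open>p\<close> is
      \<open>(1 - q) * r\<close>, largest when \<open>q\<close> is 1/3, that is for
      \<open>r\<^sup>2 = 1 / (4 * pi\<^sup>2 * n * (n + 1))\<close>. Replacing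
      \<open>4 * n * (n + 1) = N\<^sup>2 - 1\<close> by \<open>N\<^sup>2\<close> gives this
      choice.\<close>
    define r where "r = 1 / (pi * N)"
    define B where "B = (N ^ CARD('d))\<^sup>2 * (4 / (3 * (pi * N)))"
    have "pi * N \<ge> 2 * 3" using N pi_ge_two by (intro mult_mono) auto
    then have "2 * r \<le> 2 / 6" unfolding r_def by (simp add: field_simps)
    then have r: "0 \<le> r" "2 * r \<le> l"
    proof -
      show "0 \<le> r" using N by (simp add: r_def)
      show "2 * r \<le> l" using \<open>2 * r \<le> 2 / 6\<close> l_ge by linarith
    qed
    define q where "q = 4 * pi\<^sup>2 * real n * (real n + 1) / 3 * r\<^sup>2"
    define s where "s = 4 * real n * (real n + 1) / N\<^sup>2"
    have "q = s / 3"
      by (simp add: q_def r_def s_def power_divide power_mult_distrib)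
    moreover have "4 * real n * (real n + 1) \<le> N\<^sup>2"
      by (simp add: N_def power2_eq_square algebra_simps)
    then have "s \<le> 1"
      using N by (simp add: s_def divide_le_eq)
    ultimately have "q \<le> 1 / 3" by linarith
    then have "2 / 3 * (2 * r) \<le> (1 - q) * (2 * r)"
      using r(1) by (intro mult_right_mono) auto
    moreover have "2 / 3 * (2 * r) = 4 / (3 * (pi * N))" by (simp add: r_def)
    ultimately have "4 / (3 * (pi * N)) \<le> (1 - q) * (2 * r)" by (simp only:)
    then have "B \<le> (N ^ CARD('d))\<^sup>2 * ((1 - q) * (2 * r))"
      unfolding B_def by (rule mult_left_mono) auto
    then have p_ge: "B \<le> p y" if "y \<in> path_image \<gamma>" for y
      using curve_integral_norm_dirichlet_kernel_ge[OF continuous rect closed_curve piecewise_diff that r(1) r(2)[unfolded l_def], of n]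
      by (simp add: p_def N_def q_def mult.assoc)
    \<comment> \<open>The real function \<open>p\<close> is known as a finite sum only in complex
      form, hence the detour through \<open>Re\<close>.\<close>
    have "continuous_on {0..1} (\<lambda>t. Re (complex_of_real (p (\<gamma> t))))"
      unfolding p by (intro continuous_intros continuous_on_torus_char_curve[OF continuous rect])
    then have "continuous_on {0..1} (\<lambda>t. p (\<gamma> t))" by (simp only: Re_complex_of_real)
    from set_integrable_scaleR_continuous[OF w_int this]
    have pw_int: "set_integrable lebesgue {0..1} (\<lambda>s. ?v s *\<^sub>R (p (\<gamma> s) * w (\<gamma> s)))"
      by (simp add: mult_ac)
    \<comment> \<open>Non-negativity of the weight turns the pointwise bound
      \<open>B \<le> p\<close> on the trajectory into a bound for the weighted integral.\<close>
    have "B * curve_integral \<gamma> w = (LINT s:{0..1}|lebesgue. B * (?v s *\<^sub>R w (\<gamma> s)))"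
      by (simp add: curve_integral_def)
    also have "\<dots> \<le> curve_integral \<gamma> (\<lambda>x. p x * w x)"
      unfolding curve_integral_def
    proof (rule set_integral_mono)
      fix s :: real assume "s \<in> {0..1}"
      then have s: "\<gamma> s \<in> path_image \<gamma>" by (auto simp: path_image_def)
      have "B * (?v s * w (\<gamma> s)) \<le> p (\<gamma> s) * (?v s * w (\<gamma> s))"
        using p_ge[OF s] nonneg[OF s] by (intro mult_right_mono) auto
      then show "B * (?v s *\<^sub>R w (\<gamma> s)) \<le> ?v s *\<^sub>R (p (\<gamma> s) * w (\<gamma> s))"
        by (simp add: mult_ac)
    qed (use w_int pw_int in auto)
    finally have "1 / l * (B * curve_integral \<gamma> w) \<le> 1 / l * curve_integral \<gamma> (\<lambda>x. p x * w x)"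
      using l_ge by (intro mult_left_mono) auto
    then have "B * (1 / l * curve_integral \<gamma> w) \<le> N ^ CARD('d) * l"
      unfolding p_integral by (simp add: mult_ac)
    then have "N ^ CARD('d) * (N ^ CARD('d) * (4 / (3 * (pi * N)))) \<le> N ^ CARD('d) * l"
      unfolding mass by (simp add: B_def power2_eq_square mult_ac)
    then have "N ^ CARD('d) * (4 / (3 * (pi * N))) \<le> l"
      using N by (subst (asm) mult_le_cancel_left_pos) auto
    moreover have "N ^ CARD('d) = N * N ^ (CARD('d) - 1)"
      by (metis Suc_pred' power_Suc zero_less_card_finite)
    ultimately show ?thesis using N by (simp add: field_simps)
  qed
  have "0.94 / sqrt (2 * real CARD('d) + 1) * N ^ (CARD('d) - 1) \<le> l"
  proof (cases "CARD('d) = 1")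
    case True
    \<comment> \<open>In dimension one \<open>main\<close> yields only \<open>4 / (3 * pi)\<close>,
      below \<open>0.94 / sqrt 3\<close>; the covering radius bound 3/4 takes its place.\<close>
    have "1.5 \<le> sqrt (3 :: real)" by (rule real_le_rsqrt) (simp add: power2_eq_square)
    then have "0.94 / sqrt 3 \<le> 3 / (4 :: real)" by (simp add: field_simps)
    then show ?thesis using True l_ge by simp
  next
    case False
    moreover have "CARD('d) > 0" by simp
    ultimately have "CARD('d) \<ge> 2" by linarith
    \<comment> \<open>The required constant decreases with the dimension, so dimension two is the
      worst case; 2.236 is \<open>sqrt 5\<close> rounded down.\<close>
    then have "2.236 \<le> sqrt (2 * real CARD('d) + 1)"
      by (intro real_le_rsqrt) (simp add: power2_eq_square)
    then have "0.94 / sqrt (2 * real CARD('d) + 1) \<le> 0.94 / 2.236"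
      by (intro divide_left_mono) auto
    also have "\<dots> \<le> 4 / (3 * 3.17)" by simp
    also have "\<dots> \<le> 4 / (3 * pi)"
      using pi_le_317 by (intro divide_left_mono) auto
    finally have "0.94 / sqrt (2 * real CARD('d) + 1) * N ^ (CARD('d) - 1) \<le> 4 / (3 * pi) * N ^ (CARD('d) - 1)"
      using N by (intro mult_right_mono) auto
    then show ?thesis using main by linarith
  qed
  then show ?thesis by (simp add: l_def N_def)
qed

end
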